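(* Let $\mathcal{G}$ be a directed weighted graph with $n$ nodes, leader set $\mathcal{V}_L$, target set $\mathcal{V}_T$ and follower set $\mathcal{V}_F=\mathcal{V}\setminus\mathcal{V}_L$, and let $\mathcal{G}_f$ be the subgraph induced by the follower nodes. Consider the general linear multiagent system $$\dot{\tilde x}(t)=\tilde L\tilde x(t)+\tilde B\bar u(t),\qquad \tilde y(t)=\tilde H\tilde x(t),$$ with $\tilde L=I_n\otimes\tilde A-L\otimes MK$, $\tilde B=B\otimes N$, $\tilde H=H\otimes I_\sigma$. If there is an independent strongly connected component of $\mathcal{G}_f$ that contains only target nodes and the system is target controllable, then $\mathcal{G}$ is leader-target follower connected.
   Context: Graph: $\mathcal{G}$ is a simple directed weighted graph (no self-loops, no multiple edges) with nodes $v_1,\dots,v_n$; $a_{ij}=w_{ij}$ is the weight of the edge from $v_j$ to $v_i$ if it exists ($i\neq j$), and $a_{ij}=0$ otherwise. The Laplacian $L=[l_{ij}]$ has $l_{ii}=\sum_{k\neq i}a_{ik}$ and $l_{ij}=-a_{ij}$ for $i\ne j$. System: leader set $\mathcal{V}_L=\{v_1,\dots,v_l\}$, target set $\mathcal{V}_T=\{\bar v_1,\dots,\bar v_p\}\subseteq\mathcal{V}$; $B=[e_{v_1},\dots,e_{v_l}]$, $H=[e_{\bar v_1},\dots,e_{\bar v_p}]^T$, with $e_i$ the standard basis vector indexed by the node. Each agent has state $\tilde x_i\in\mathbb{R}^\sigma$; $\tilde A\in\mathbb{R}^{\sigma\times\sigma}$, and $M$, $N$, $K$ (feedback gain) are real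 matrices of compatible sizes ($MK\in\mathbb{R}^{\sigma\times\sigma}$, $N$ has $\sigma$ rows). The agent dynamics are $\dot{\tilde x}_i=\tilde A\tilde x_i+Mz_i+N\bar u_i$ for leaders, $\dot{\tilde x}_i=\tilde A\tilde x_i+Mz_i$ for followers, where $z_i=K\sum_{j\in\mathcal{N}_i}a_{ij}(\tilde x_j-\tilde x_i)$ and $\mathcal{N}_i$ is the set of nodes with an edge to $v_i$; the output consists of the states of the target nodes. The system is target controllable if for any initial state $\tilde x(t_0)\in\mathbb{R}^{n\sigma}$ and any $y_f\in\mathbb{R}^{p\sigma}$ there is an input with $\tilde y(t_f)=y_f$ ($t_0<t_f$ finite); equivalently $[\tilde H\tilde B,\tilde H\tilde L\tilde B,\dots,\tilde H\tilde L^{n\sigma-1}\tilde B]$ has full row rank. A strongly connected component of a digraph is a maximal strongly connected induced subgraph; it is independent if there are no incoming edges to any of its nodes from other strongly connected components of that digraph. $\mathcal{G}$ is leader-target follower connected if there is an independent strongly connected component of $\mathcal{G}_f$ that contains only target nodes and there is an edge of $\mathcal{G}$ from a leader to a node in that component. *)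

theory Defs
  imports "HOL-Analysis.Analysis" "Graph_Theory.Digraph_Component"
begin

section \<open>Weighted digraphs and matrices\<close>

text \<open>
  Nodes are the elements of a finite type. An arc \<open>(j, i)\<close> points from \<open>j\<close> to \<open>i\<close>, so row \<open>i\<close> of the
  adjacency matrix collects the weights of the arcs entering \<open>i\<close>.
\<close>

definition adjacency :: "'n pair_pre_digraph \<Rightarrow> ('n \<times> 'n \<Rightarrow> real) \<Rightarrow> real^'n^'n" where
  "adjacency G w = (\<chi> i j. if (j, i) \<in> parcs G then w (j, i) else 0)"

definition laplacian :: "'n::finite pair_pre_digraph \<Rightarrow> ('n \<times> 'n \<Rightarrow> real) \<Rightarrow> real^'n^'n" where
  "laplacian G w = (\<chi> i j. if i = j then (\<Sum>k\<in>UNIV - {i}. adjacency G w $ i $ k)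
                           else - adjacency G w $ i $ j)"

text \<open>Kronecker product; stacked vectors are indexed by pairs (outer index, inner index).\<close>

definition kronecker :: "real^'b^'a \<Rightarrow> real^'d^'c \<Rightarrow> real^('b \<times> 'd)^('a \<times> 'c)"
    (infixl \<open>\<otimes>\<^sub>K\<close> 70) where
  "A \<otimes>\<^sub>K B = (\<chi> i j. A $ fst i $ fst j * B $ snd i $ snd j)"

text \<open>The matrix whose rows are the standard basis vectors of the nodes enumerated by \<open>v\<close>.\<close>

definition selection :: "('k::finite \<Rightarrow> 'n::finite) \<Rightarrow> real^'n^'k" where
  "selection v = (\<chi> k. axis (v k) 1)"

section \<open>The multiagent system\<close>

definition system_matrix ::
    "'n::finite pair_pre_digraph \<Rightarrow> ('n \<times> 'n \<Rightarrow> real) \<Rightarrow> real^'s^'s \<Rightarrow> real^'m^'s \<Rightarrow> real^'s^'m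
      \<Rightarrow> real^('n \<times> 's)^('n \<times> 's)" where
  "system_matrix G w A M K = mat 1 \<otimes>\<^sub>K A - laplacian G w \<otimes>\<^sub>K (M ** K)"

definition input_matrix :: "('l::finite \<Rightarrow> 'n::finite) \<Rightarrow> real^'q^'s \<Rightarrow> real^('l \<times> 'q)^('n \<times> 's)" where
  "input_matrix leader N = transpose (selection leader) \<otimes>\<^sub>K N"

definition output_matrix :: "('p::finite \<Rightarrow> 'n::finite) \<Rightarrow> real^('n \<times> 's::finite)^('p \<times> 's)" where
  "output_matrix target = selection target \<otimes>\<^sub>K mat 1"

section \<open>Target controllability\<close>

text \<open>Admissible inputs are piecewise continuous: finitely many jumps, with one-sided limits there.\<close>

definition piecewise_continuous_on ::
    "real \<Rightarrow> real \<Rightarrow> (real \<Rightarrow> 'a::topological_space) \<Rightarrow> bool" where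
  "piecewise_continuous_on a b u \<longleftrightarrow>
     (\<exists>F. finite F \<and> continuous_on ({a..b} - F) u) \<and>
     (\<forall>t\<in>{a..b}. (\<exists>l. (u \<longlongrightarrow> l) (at t within {a..<t})) \<and>
                 (\<exists>r. (u \<longlongrightarrow> r) (at t within {t<..b})))"

text \<open>Finitely many times are exempt from the differential equation because the input may jump.\<close>

definition state_trajectory ::
    "real^'x^'x \<Rightarrow> real^'u^'x \<Rightarrow> real \<Rightarrow> real \<Rightarrow> (real \<Rightarrow> real^'u) \<Rightarrow> (real \<Rightarrow> real^'x) \<Rightarrow> bool" where
  "state_trajectory A B t0 tf u x \<longleftrightarrow>
     continuous_on {t0..tf} x \<and>
     (\<exists>F. finite F \<and> (\<forall>t\<in>{t0..tf} - F.
        (x has_vector_derivative (A *v x t + B *v u t)) (at t within {t0..tf})))"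

definition target_controllable ::
    "real \<Rightarrow> real^'x^'x \<Rightarrow> real^'u^'x \<Rightarrow> real^'x^'y \<Rightarrow> bool" where
  "target_controllable t0 A B H \<longleftrightarrow>
     (\<forall>x0 yf. \<exists>tf>t0. \<exists>u x. piecewise_continuous_on t0 tf u \<and> state_trajectory A B t0 tf u x \<and>
        x t0 = x0 \<and> H *v x tf = yf)"

section \<open>Leader-target follower connectedness\<close>

definition independent_scc :: "('a, 'b) pre_digraph \<Rightarrow> ('a, 'b) pre_digraph \<Rightarrow> bool" where
  "independent_scc D S \<longleftrightarrow> S \<in> pre_digraph.sccs D \<and>
     (\<forall>T\<in>pre_digraph.sccs D. T \<noteq> S \<longrightarrow> \<not> (\<exists>u\<in>verts T. \<exists>v\<in>verts S. u \<rightarrow>\<^bsub>D\<^esub> v))"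

definition follower_subgraph :: "('a, 'b) pre_digraph \<Rightarrow> 'a set \<Rightarrow> ('a, 'b) pre_digraph" where
  "follower_subgraph G VL = G \<restriction> (verts G - VL)"

definition leader_target_follower_connected ::
    "('a, 'b) pre_digraph \<Rightarrow> 'a set \<Rightarrow> 'a set \<Rightarrow> bool" where
  "leader_target_follower_connected G VL VT \<longleftrightarrow>
     (\<exists>S. independent_scc (follower_subgraph G VL) S \<and> verts S \<subseteq> VT \<and>
          (\<exists>u\<in>VL. \<exists>v\<in>verts S. u \<rightarrow>\<^bsub>G\<^esub> v))"

end

theory Submission
  imports Defs
begin

text \<open>
  No arc enters an independent strongly connected component of the follower graph from another
  follower. If no arc enters it from a leader either, its nodes obey a homogeneous linear
  differential equation of their own, free of inputs. Started at zero, their states remain zero, so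
  the outputs of the targets in the component cannot be steered to a nonzero value.
\<close>

text \<open>Gronwall argument: with \<open>c\<close> the operator norm of \<open>A\<close>,
  Cauchy-Schwarz bounds half the derivative of \<open>z t \<bullet> z t\<close> by
  \<open>c * (z t \<bullet> z t)\<close>, so the weight \<open>exp (- 2 * c * t)\<close> makes the
  squared norm nonincreasing.\<close>

lemma linear_ode_zero:
  fixes z :: "real \<Rightarrow> real^'n" and A :: "real^'n^'n"
  assumes "finite F" and "a \<le> b" and cont: "continuous_on {a..b} z"
    and deriv: "\<And>t. t \<in> {a..b} - F \<Longrightarrow> (z has_vector_derivative A *v z t) (at t within {a..b})"
    and init: "z a = 0"
  shows "z b = 0"
proof -
  define c where "c = onorm ((*v) A)"
  define E where "E = (\<lambda>t. exp (- 2 * c * t) * (z t \<bullet> z t))"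
  define E' where "E' = (\<lambda>t. exp (- 2 * c * t) * (2 * (z t \<bullet> (A *v z t)) - 2 * c * (z t \<bullet> z t)))"
  have nonpos: "E' t \<le> 0" for t
  proof -
    have "z t \<bullet> (A *v z t) \<le> norm (z t) * norm (A *v z t)"
      by (rule norm_cauchy_schwarz)
    also have "\<dots> \<le> norm (z t) * (c * norm (z t))"
      unfolding c_def by (intro mult_left_mono onorm) auto
    also have "\<dots> = c * (z t \<bullet> z t)"
      by (simp add: dot_square_norm power2_eq_square)
    finally show ?thesis
      unfolding E'_def by (simp add: mult_nonneg_nonpos)
  qed
  \<comment> \<open>This form of the fundamental theorem needs only continuity of \<open>E\<close>
    at the finitely many exceptional times in \<open>F\<close>.\<close>
  have "(E' has_integral (E b - E a)) {a..b}"
  proof (rule fundamental_theorem_of_calculus_interior_strong[OF \<open>finite F\<close> \<open>a \<le> b\<close>])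
    show "continuous_on {a..b} E"
      unfolding E_def by (intro continuous_intros cont)
  next
    fix t assume t: "t \<in> {a<..<b} - F"
    then have "(z has_vector_derivative A *v z t) (at t)"
      using deriv[of t] by (simp add: at_within_Icc_at)
    then have z: "(z has_derivative (\<lambda>h. h *\<^sub>R (A *v z t))) (at t)"
      by (simp add: has_vector_derivative_def)
    have "((\<lambda>t. z t \<bullet> z t) has_real_derivative 2 * (z t \<bullet> (A *v z t))) (at t)"
      using has_derivative_inner[OF z z]
      by (rule has_derivative_imp_has_field_derivative) (simp add: inner_commute)
    moreover
    have "((\<lambda>t. exp (- 2 * c * t)) has_real_derivative exp (- 2 * c * t) * (- 2 * c)) (at t)"
      by (rule derivative_eq_intros refl)+ simp
    ultimately show "(E has_vector_derivative E' t) (at t)"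
      unfolding E_def E'_def has_real_derivative_iff_has_vector_derivative[symmetric]
      by (auto intro: DERIV_cong[OF DERIV_mult] simp: algebra_simps)
  qed
  then have "E b - E a \<le> 0"
    by (rule has_integral_le[OF _ has_integral_0]) (rule nonpos)
  then have "z b \<bullet> z b \<le> 0"
    by (simp add: E_def init mult_le_0_iff)
  then show ?thesis
    by (metis antisym inner_ge_zero inner_eq_zero_iff)
qed

text \<open>The coordinates in \<open>C\<close> receive nothing from the input or from coordinates
  outside \<open>C\<close>, so they solve an autonomous linear equation with zero initial
  value.\<close>

lemma state_trajectory_vanishes:
  assumes traj: "state_trajectory A B t0 tf u x" and "t0 \<le> tf" and init: "x t0 = 0"
    and A: "\<And>i j. i \<in> C \<Longrightarrow> j \<notin> C \<Longrightarrow> A $ i $ j = 0"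
    and B: "\<And>i k. i \<in> C \<Longrightarrow> B $ i $ k = 0"
    and "i \<in> C"
  shows "x tf $ i = 0"
proof -
  \<comment> \<open>Projecting onto the coordinates in \<open>C\<close> keeps the full index type,
    so no index type for \<open>C\<close> itself has to be built.\<close>
  define P :: "real^'a^'a" where "P = (\<chi> i j. if i = j \<and> i \<in> C then 1 else 0)"
  have P: "(P *v y) $ i = (if i \<in> C then y $ i else 0)" for y i
    by (simp add: P_def matrix_vector_mult_def if_distrib[of "\<lambda>c. c * _"] cong: if_cong)
  obtain F where F: "finite F" and deriv: "\<And>t. t \<in> {t0..tf} - F \<Longrightarrow>
      (x has_vector_derivative (A *v x t + B *v u t)) (at t within {t0..tf})"
    using traj by (auto simp: state_trajectory_def)
  \<comment> \<open>The input drops out, and \<open>P *v x t\<close> satisfies a linear equation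
    with matrix \<open>P ** A\<close>.\<close>
  have closed: "P *v (A *v y + B *v v) = (P ** A) *v (P *v y)" for y v
  proof (rule vec_eq_iff[THEN iffD2], rule allI)
    fix i
    have "(A *v y + B *v v) $ i = (A *v (P *v y)) $ i" if "i \<in> C"
    proof -
      have "A $ i $ j * y $ j = A $ i $ j * (P *v y) $ j" for j
        using that A[of i j] by (cases "j \<in> C") (simp_all add: P)
      then have "(A *v y) $ i = (A *v (P *v y)) $ i"
        unfolding matrix_vector_mult_def[of A] vec_lambda_beta by (intro sum.cong refl)
      moreover have "(B *v v) $ i = 0"
        using that B by (simp add: matrix_vector_mult_def)
      ultimately show ?thesis
        by simp
    qed
    then show "(P *v (A *v y + B *v v)) $ i = ((P ** A) *v (P *v y)) $ i"
      by (simp add: P flip: matrix_vector_mul_assoc)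
  qed
  have "P *v x tf = 0"
  proof (rule linear_ode_zero[OF F \<open>t0 \<le> tf\<close>])
    show "continuous_on {t0..tf} (\<lambda>t. P *v x t)"
      using traj by (auto simp: state_trajectory_def
          intro!: bounded_linear.continuous_on[OF matrix_vector_mul_bounded_linear])
    show "((\<lambda>t. P *v x t) has_vector_derivative (P ** A) *v (P *v x t)) (at t within {t0..tf})"
      if "t \<in> {t0..tf} - F" for t
      using bounded_linear.has_vector_derivative[OF matrix_vector_mul_bounded_linear deriv[OF that], of P]
      by (simp add: closed)
  qed (simp add: init)
  then show ?thesis
    using P[of "x tf" i] \<open>i \<in> C\<close> by simp
qed

text \<open>The tail \<open>u\<close> lies in some strongly connected component \<open>T\<close>;
  were \<open>T\<close> different from \<open>S\<close>, the arc would contradict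
  independence.\<close>

lemma independent_scc_arc_into:
  assumes "wf_digraph D" and S: "independent_scc D S"
    and arc: "u \<rightarrow>\<^bsub>D\<^esub> v" and "v \<in> verts S"
  shows "u \<in> verts S"
proof -
  interpret wf_digraph D by fact
  have "u \<in> verts D"
    using arc by (rule adj_in_verts)
  then have "scc_of u \<in> verts ` sccs"
    unfolding sccs_verts_conv[symmetric] by (rule scc_of_in_sccs_verts)
  then obtain T where "T \<in> sccs" "verts T = scc_of u"
    by (metis imageE)
  moreover from this have "u \<in> verts T"
    using in_scc_of_self[OF \<open>u \<in> verts D\<close>] by simp
  ultimately have "T = S"
    using S arc \<open>v \<in> verts S\<close> unfolding independent_scc_def by metis
  then show ?thesis
    using \<open>u \<in> verts T\<close> by simp
qed

theorem proposition3:
  fixes G :: "'n::finite pair_pre_digraph" and w :: "'n \<times> 'n \<Rightarrow> real"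
    and leader :: "'l::finite \<Rightarrow> 'n" and target :: "'p::finite \<Rightarrow> 'n"
    and A :: "real^'s::finite^'s" and M :: "real^'m::finite^'s" and K :: "real^'s^'m"
    and N :: "real^'q::finite^'s" and t0 :: real
  assumes "pair_digraph G" and "pverts G = UNIV"
    and "inj leader" and "inj target"
    and "\<exists>S. independent_scc (follower_subgraph (with_proj G) (range leader)) S \<and>
             verts S \<subseteq> range target"
    and "target_controllable t0
           (system_matrix G w A M K) (input_matrix leader N) (output_matrix target)"
  shows "leader_target_follower_connected (with_proj G) (range leader) (range target)"
proof (rule ccontr)
  interpret pair_digraph G by fact
  let ?D = "follower_subgraph (with_proj G) (range leader)"
  assume not_connected: "\<not> ?thesis"
  obtain S where S: "independent_scc ?D S" "verts S \<subseteq> range target"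
    using assms(5) by blast
  have wf: "wf_digraph ?D"
    unfolding follower_subgraph_def by (rule wellformed_induce_subgraph)
  have S_scc: "S \<in> pre_digraph.sccs ?D"
    using S(1) by (simp add: independent_scc_def)
  then have "verts S \<noteq> {}" and "verts S \<subseteq> verts ?D"
    by (auto simp: pre_digraph.sccs_def strongly_connected_def)
  then have follower: "leader k \<notin> verts S" for k
    by (auto simp: follower_subgraph_def)
  obtain p where p: "target p \<in> verts S"
    using \<open>verts S \<noteq> {}\<close> S(2) by blast
  \<comment> \<open>A leader as tail would make the graph leader-target follower connected.
    Otherwise \<open>j\<close> is a follower, so the arc survives in \<open>?D\<close> and
    independence applies.\<close>
  have closed: "j \<in> verts S" if arc: "(j, i) \<in> parcs G" and i: "i \<in> verts S" for i j
  proof -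
    have "j \<notin> range leader"
      using not_connected S arc i by (auto simp: leader_target_follower_connected_def)
    moreover have "i \<in> verts ?D"
      using i \<open>verts S \<subseteq> verts ?D\<close> by blast
    ultimately have "j \<rightarrow>\<^bsub>?D\<^esub> i"
      using arc assms(2) by (force simp: follower_subgraph_def arcs_ends_conv)
    then show ?thesis
      by (rule independent_scc_arc_into[OF wf S(1) _ i])
  qed
  \<comment> \<open>All state coordinates of the agents in the component.\<close>
  define C :: "('n \<times> 's) set" where "C = verts S \<times> UNIV"
  \<comment> \<open>The nodes of \<open>a\<close> and \<open>b\<close> differ, so the entry lies in
    an off-diagonal block, a multiple of \<open>M ** K\<close> by the weight of an arc that
    \<open>closed\<close> rules out.\<close>
  have system: "system_matrix G w A M K $ a $ b = 0" if "a \<in> C" "b \<notin> C" for a b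
    using that closed[of "fst b" "fst a"]
    by (cases a; cases b) (auto simp: C_def system_matrix_def kronecker_def mat_def laplacian_def adjacency_def)
  have no_input: "input_matrix leader N $ a $ k = 0" if "a \<in> C" for a k
    using that follower[of "fst k"]
    by (auto simp: C_def input_matrix_def kronecker_def transpose_def selection_def axis_def)
  have observed: "(output_matrix target *v y) $ k = y $ (target (fst k), snd k)"
    for y :: "real^('n \<times> 's)" and k :: "'p \<times> 's"
  proof -
    have "(output_matrix target *v y) $ k =
        (\<Sum>b\<in>UNIV. if b = (target (fst k), snd k) then y $ b else 0)"
      unfolding matrix_vector_mult_def vec_lambda_beta
      by (intro sum.cong refl) (auto simp: output_matrix_def kronecker_def selection_def axis_def mat_def)
    then show ?thesis
      by simp
  qed
  \<comment> \<open>Demand the all-ones output from the zero state; its entries for the target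
    \<open>p\<close> are the unreachable ones.\<close>
  obtain tf u x where "t0 < tf" "x t0 = 0" "output_matrix target *v x tf = 1"
    and traj: "state_trajectory (system_matrix G w A M K) (input_matrix leader N) t0 tf u x"
    using assms(6) unfolding target_controllable_def by blast
  moreover have "x tf $ (target p, s) = 0" for s
    using \<open>t0 < tf\<close> \<open>x t0 = 0\<close> p
    by (intro state_trajectory_vanishes[where C = C, OF traj _ _ system no_input])
      (simp_all add: C_def mem_Times_iff)
  \<comment> \<open>Here \<open>undefined\<close> is merely some coordinate of the agent
    state.\<close>
  ultimately have "(1 :: real^('p \<times> 's)) $ (p, undefined) = 0"
    using observed[of "x tf" "(p, undefined)"] by auto
  then show False
    by simp
qed

end
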